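(* Let $\mathcal{P}$ be a finite index set, $\{A_p : p\in\mathcal{P}\}$ a collection of real $n\times n$ matrices, each either stable or unstable, and $\mathcal{R}=\{R_{(p,q)} : p,q\in\mathcal{P}\}$ a collection of real $n\times n$ matrices. Suppose there exist a collection of symmetric positive definite matrices $\{Q_p\in M_n(\mathbb{R}) : p\in\mathcal{P}\}$ and positive constants $\lambda_p$ for $p\in\mathfrak{s}$, $\mu_p$ for $p\in\mathfrak{u}$, and $\gamma_{(p,q)}$ for $p,q\in\mathcal{P}$ satisfying $$Q_pA_p+A_p^\top Q_p\le-\lambda_pQ_p\ \text{ for all }p\in\mathfrak{s},\qquad Q_pA_p+A_p^\top Q_p\le\mu_pQ_p\ \text{ for all }p\in\mathfrak{u},$$ $$R_{(p,q)}^\top Q_qR_{(p,q)}\le\gamma_{(p,q)}Q_p\ \text{ for all }p,q\in\mathcal{P}.$$ Let $\lambda=\min_{p\in\mathfrak{s}}\lambda_p$, $\mu=\max_{p\in\mathfrak{u}}\mu_p$ and $\gamma=\max_{p,q\in\mathcal{P}}\gamma_{(p,q)}$. Let $\tau,\eta>0$. Then for any signal $\sigma\in\mathcal{S}[\tau,\eta]$ satisfying $$\limsup_{t\to\infty}\left(-\lambda\,N_s(0,t)\,\tau+\mu\,N_u(0,t)\,\eta+N(0,t)\ln\gamma\right)<0,$$ the reset switched system $\dot x(t)=A_{\sigma(t)}x(t)$, $x(t_k)=R_{(\sigma(t_{k-1}),\sigma(t_k))}\,x(t_k^-)$ ($k\ge1$) is stable.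
   Context: A real matrix is called stable if all its eigenvalues have negative real part, and unstable if at least one eigenvalue has positive real part; $\mathfrak{s},\mathfrak{u}\subseteq\mathcal{P}$ are the sets of indices $p$ with $A_p$ stable, resp. unstable. For symmetric matrices, $\le$ denotes the Loewner order. A switching signal is a right-continuous piecewise constant function $\sigma:[0,\infty)\to\mathcal{P}$ whose set of discontinuities $\{t_k\}_{k\ge1}$ (switching times) is an increasing sequence with $t_k\uparrow\infty$; put $t_0=0$. $\mathcal{S}[\tau,\eta]$ is the set of switching signals such that for all $k\ge1$: $t_k-t_{k-1}\ge\tau$ if $\sigma(t_{k-1})\in\mathfrak{s}$, and $t_k-t_{k-1}\le\eta$ if $\sigma(t_{k-1})\in\mathfrak{u}$. Define $N_s(0,t)=\#\{i : 0\le t_i<t,\ \sigma(t_i)\in\mathfrak{s}\}$, $N_u(0,t)=\#\{i : 0\le t_i<t,\ \sigma(t_i)\in\mathfrak{u}\}$, $N(0,t)=N_s(0,t)+N_u(0,t)$. (If $\mathfrak{s}$ or $\mathfrak{u}$ is empty, the term with $\lambda$, resp. $\mu$, is zero.) In the reset switched system, $\dot x=A_{\sigma(t)}x$ holds on each $[t_{k-1},t_k)$ and $x(t_k^-)=\lim_{t\to t_k^-}x(t)$. The system (for fixed $\sigma$) is stable if for every $\epsilon>0$ there is $\delta>0$ such that $\|x(0)\|<\delta$ implies $\|x(t)\|<\epsilon$ for all $t>0$ (Euclidean norm). *)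

theory Defs
  imports "HOL-Analysis.Analysis"
begin

section \<open>Stable and unstable matrices\<close>

text \<open>Eigenvalues of a real matrix are its complex eigenvalues, with complex eigenvectors.\<close>

definition eigenvalues :: "real^'n^'n \<Rightarrow> complex set" where
  "eigenvalues A =
    {z. \<exists>v :: complex^'n. v \<noteq> 0 \<and> map_matrix complex_of_real A *v v = z *s v}"

definition stable_matrix :: "real^'n^'n \<Rightarrow> bool" where
  "stable_matrix A \<longleftrightarrow> (\<forall>z \<in> eigenvalues A. Re z < 0)"

definition unstable_matrix :: "real^'n^'n \<Rightarrow> bool" where
  "unstable_matrix A \<longleftrightarrow> (\<exists>z \<in> eigenvalues A. Re z > 0)"

definition stable_idx :: "('p \<Rightarrow> real^'n^'n) \<Rightarrow> 'p set" where
  "stable_idx A = {p. stable_matrix (A p)}"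

definition unstable_idx :: "('p \<Rightarrow> real^'n^'n) \<Rightarrow> 'p set" where
  "unstable_idx A = {p. unstable_matrix (A p)}"


section \<open>Definiteness and the Loewner order\<close>

definition pos_def :: "real^'n^'n \<Rightarrow> bool" where
  "pos_def M \<longleftrightarrow> transpose M = M \<and> (\<forall>x. x \<noteq> 0 \<longrightarrow> 0 < x \<bullet> (M *v x))"

definition pos_semidef :: "real^'n^'n \<Rightarrow> bool" where
  "pos_semidef M \<longleftrightarrow> transpose M = M \<and> (\<forall>x. 0 \<le> x \<bullet> (M *v x))"

text \<open>The library order \<open>\<le>\<close> on \<open>real^'n^'n\<close> is entrywise, hence a separate notation.\<close>

definition loewner_le :: "real^'n^'n \<Rightarrow> real^'n^'n \<Rightarrow> bool" (infix "\<le>\<^sub>L" 50) where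
  "M \<le>\<^sub>L M' \<longleftrightarrow> pos_semidef (M' - M)"


section \<open>Switching signals\<close>

text \<open>
  A signal is given by its restriction to \<open>[0,\<infinity>)\<close>; values at negative times play no role.
  The index set carries the discrete topology, so continuity at a point means being locally
  constant there.
\<close>

definition discontinuities :: "(real \<Rightarrow> 'p) \<Rightarrow> real set" where
  "discontinuities \<sigma> = {s. 0 \<le> s \<and> \<not> (\<forall>\<^sub>F r in at s within {0..}. \<sigma> r = \<sigma> s)}"

text \<open>
  \<open>t 1, t 2, \<dots>\<close> enumerates all discontinuities in increasing order, and \<open>t 0 = 0\<close>; in particular
  there are infinitely many switching times and \<open>\<sigma>\<close> changes its value at each of them.
\<close>

definition has_switching_times :: "(real \<Rightarrow> 'p) \<Rightarrow> (nat \<Rightarrow> real) \<Rightarrow> bool" where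
  "has_switching_times \<sigma> t \<longleftrightarrow>
     t 0 = 0 \<and> strict_mono t \<and> filterlim t at_top sequentially \<and>
     discontinuities \<sigma> = t ` {1..} \<and>
     (\<forall>k. \<sigma> constant_on {t k<..<t (Suc k)}) \<and>
     (\<forall>s\<ge>0. \<forall>\<^sub>F r in at_right s. \<sigma> r = \<sigma> s)"

definition switching_signal :: "(real \<Rightarrow> 'p) \<Rightarrow> bool" where
  "switching_signal \<sigma> \<longleftrightarrow> (\<exists>t. has_switching_times \<sigma> t)"

definition switching_time :: "(real \<Rightarrow> 'p) \<Rightarrow> nat \<Rightarrow> real" where
  "switching_time \<sigma> = (THE t. has_switching_times \<sigma> t)"

lemma has_switching_times_unique:
  assumes "has_switching_times \<sigma> t" and "has_switching_times \<sigma> t'"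
  shows "t = t'"
proof
  have rng: "range u = insert 0 (discontinuities \<sigma>)" if "has_switching_times \<sigma> u" for u
  proof -
    have "(UNIV :: nat set) = insert 0 {1..}" by auto
    then have "range u = insert (u 0) (u ` {1..})" by (metis image_insert)
    with that show ?thesis by (simp add: has_switching_times_def)
  qed
  have sm: "strict_mono t" "strict_mono t'"
    using assms by (auto simp: has_switching_times_def)
  have le: "\<not> u n < w n"
    if u: "strict_mono u" and w: "strict_mono w" and r: "range u = range w"
      and IH: "\<And>m. m < n \<Longrightarrow> u m = w m"
    for u w :: "nat \<Rightarrow> real" and n
  proof
    assume less: "u n < w n"
    obtain m where m: "u n = w m" using r by (metis rangeE rangeI)
    then have "m < n" using less w by (simp add: strict_mono_less)
    then show False using u IH[of m] m by (metis strict_mono_less less_irrefl)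
  qed
  fix n
  show "t n = t' n"
  proof (induction n rule: less_induct)
    case (less n)
    then show ?case
      using le[of t t' n] le[of t' t n] sm rng[OF assms(1)] rng[OF assms(2)] by force
  qed
qed

lemma has_switching_times_switching_time:
  "switching_signal \<sigma> \<Longrightarrow> has_switching_times \<sigma> (switching_time \<sigma>)"
  unfolding switching_signal_def switching_time_def
  by (metis has_switching_times_unique theI)

definition signal_class ::
    "('p \<Rightarrow> real^'n^'n) \<Rightarrow> real \<Rightarrow> real \<Rightarrow> (real \<Rightarrow> 'p) set" where
  "signal_class A \<tau> \<eta> =
    {\<sigma>. switching_signal \<sigma> \<and>
      (\<forall>k\<ge>1.
        (\<sigma> (switching_time \<sigma> (k - 1)) \<in> stable_idx A \<longrightarrow>
           switching_time \<sigma> k - switching_time \<sigma> (k - 1) \<ge> \<tau>) \<and>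
        (\<sigma> (switching_time \<sigma> (k - 1)) \<in> unstable_idx A \<longrightarrow>
           switching_time \<sigma> k - switching_time \<sigma> (k - 1) \<le> \<eta>))}"

definition N_s :: "('p \<Rightarrow> real^'n^'n) \<Rightarrow> (real \<Rightarrow> 'p) \<Rightarrow> real \<Rightarrow> nat" where
  "N_s A \<sigma> t = card {i. 0 \<le> switching_time \<sigma> i \<and> switching_time \<sigma> i < t \<and>
                         \<sigma> (switching_time \<sigma> i) \<in> stable_idx A}"

definition N_u :: "('p \<Rightarrow> real^'n^'n) \<Rightarrow> (real \<Rightarrow> 'p) \<Rightarrow> real \<Rightarrow> nat" where
  "N_u A \<sigma> t = card {i. 0 \<le> switching_time \<sigma> i \<and> switching_time \<sigma> i < t \<and>
                         \<sigma> (switching_time \<sigma> i) \<in> unstable_idx A}"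

definition N_total :: "('p \<Rightarrow> real^'n^'n) \<Rightarrow> (real \<Rightarrow> 'p) \<Rightarrow> real \<Rightarrow> nat" where
  "N_total A \<sigma> t = N_s A \<sigma> t + N_u A \<sigma> t"


section \<open>The reset switched system\<close>

text \<open>
  At the left end point of an interval \<open>[t\<^bsub>k-1\<^esub>, t\<^bsub>k\<^esub>)\<close> the derivative is the one-sided one.
  Here \<open>R p q\<close> is the reset applied when switching from \<open>p\<close> to \<open>q\<close>.
\<close>

definition reset_solution ::
    "('p \<Rightarrow> real^'n^'n) \<Rightarrow> ('p \<Rightarrow> 'p \<Rightarrow> real^'n^'n) \<Rightarrow> (real \<Rightarrow> 'p) \<Rightarrow> (real \<Rightarrow> real^'n) \<Rightarrow> bool" where
  "reset_solution A R \<sigma> x \<longleftrightarrow>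
    (\<forall>k\<ge>1.
      (\<forall>t \<in> {switching_time \<sigma> (k - 1)..<switching_time \<sigma> k}.
         (x has_vector_derivative A (\<sigma> t) *v x t)
           (at t within {switching_time \<sigma> (k - 1)..<switching_time \<sigma> k})) \<and>
      (\<exists>l. (x \<longlongrightarrow> l) (at_left (switching_time \<sigma> k)) \<and>
           x (switching_time \<sigma> k) =
             R (\<sigma> (switching_time \<sigma> (k - 1))) (\<sigma> (switching_time \<sigma> k)) *v l))"

definition reset_stable ::
    "('p \<Rightarrow> real^'n^'n) \<Rightarrow> ('p \<Rightarrow> 'p \<Rightarrow> real^'n^'n) \<Rightarrow> (real \<Rightarrow> 'p) \<Rightarrow> bool" where
  "reset_stable A R \<sigma> \<longleftrightarrow>
    (\<forall>\<epsilon>>0. \<exists>\<delta>>0. \<forall>x. reset_solution A R \<sigma> x \<longrightarrow> norm (x 0) < \<delta> \<longrightarrow> (\<forall>t>0. norm (x t) < \<epsilon>))"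

end

(* Along a solution, V(t) = x(t) . Q_{\<sigma>(t)} x(t) is multiplied over the k-th switching interval and the
   subsequent reset by at most \<gamma> exp(-\<lambda>\<tau>) or \<gamma> exp(\<mu>\<eta>), according to whether the active matrix is stable
   or unstable. The product of these factors over i < k is exp F(t_k), F being the function whose limit
   superior is negative. So F(t_k) is bounded above, hence V is bounded by a multiple of V(0), and V is
   equivalent to the squared norm uniformly in the finitely many Q_p. *)
theory Submission
  imports Defs
begin

section \<open>Quadratic forms: norm equivalence and exponential growth along linear flows\<close>

lemma loewner_leD:
  assumes "M \<le>\<^sub>L M'"
  shows "x \<bullet> (M *v x) \<le> x \<bullet> (M' *v x)"
  using assms by (simp add: loewner_le_def pos_semidef_def matrix_vector_mult_diff_rdistrib inner_diff_right)

lemma inner_transpose_matrix: "x \<bullet> (transpose B *v y) = (B *v x) \<bullet> (y :: real^'n)"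
  by (metis dot_lmul_matrix inner_commute transpose_matrix_vector)

text \<open>The constants are the minimum and maximum of the form on the unit sphere, attained by
  compactness; homogeneity of degree 2 carries the bounds to all vectors.\<close>

lemma pos_def_norm_bounds:
  fixes M :: "real^'n^'n"
  assumes "pos_def M"
  obtains a b where "0 < a" "0 < b"
    "\<And>x. a * (norm x)\<^sup>2 \<le> x \<bullet> (M *v x)" "\<And>x. x \<bullet> (M *v x) \<le> b * (norm x)\<^sup>2"
proof -
  let ?S = "sphere (0 :: real^'n) 1"
  let ?f = "\<lambda>x. x \<bullet> (M *v x)"
  have cont: "continuous_on ?S ?f"
    by (intro continuous_intros linear_continuous_on matrix_vector_mul_bounded_linear)
  have ne: "?S \<noteq> {}" by simp
  obtain u where u: "u \<in> ?S" "\<And>y. y \<in> ?S \<Longrightarrow> ?f u \<le> ?f y"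
    using continuous_attains_inf[OF compact_sphere ne cont] by blast
  obtain v where v: "v \<in> ?S" "\<And>y. y \<in> ?S \<Longrightarrow> ?f y \<le> ?f v"
    using continuous_attains_sup[OF compact_sphere ne cont] by blast
  have pos: "0 < ?f w" if "w \<in> ?S" for w
    using assms that unfolding pos_def_def by (metis norm_zero mem_sphere_0 zero_neq_one)
  have scale: "?f x = (norm x)\<^sup>2 * ?f (x /\<^sub>R norm x)" for x
    by (cases "x = 0") (simp_all add: matrix_vector_mult_scaleR power2_eq_square field_simps)
  have unit: "x /\<^sub>R norm x \<in> ?S" if "x \<noteq> 0" for x :: "real^'n"
    using that by simp
  have "?f u * (norm x)\<^sup>2 \<le> ?f x \<and> ?f x \<le> ?f v * (norm x)\<^sup>2" for x
  proof (cases "x = 0")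
    case False
    then have "?f u \<le> ?f (x /\<^sub>R norm x)" "?f (x /\<^sub>R norm x) \<le> ?f v"
      using u(2) v(2) unit by blast+
    then show ?thesis
      unfolding scale[of x] mult.commute[of _ "(norm x)\<^sup>2"] by (intro conjI mult_left_mono zero_le_power2)
  qed simp
  then show ?thesis
    using that[of "?f u" "?f v"] pos u(1) v(1) by blast
qed

text \<open>The active form changes from one switching interval to the next, so the constants must
  not depend on the index; with finitely many indices, extremes of the individual constants
  do.\<close>

lemma pos_def_family_norm_bounds:
  fixes Q :: "'p::finite \<Rightarrow> real^'n^'n"
  assumes "\<And>p. pos_def (Q p)"
  obtains a b where "0 < a" "0 < b"
    "\<And>p x. a * (norm x)\<^sup>2 \<le> x \<bullet> (Q p *v x)" "\<And>p x. x \<bullet> (Q p *v x) \<le> b * (norm x)\<^sup>2"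
proof -
  have "\<exists>a b. 0 < a \<and> 0 < b \<and>
      (\<forall>x. a * (norm x)\<^sup>2 \<le> x \<bullet> (Q p *v x) \<and> x \<bullet> (Q p *v x) \<le> b * (norm x)\<^sup>2)" for p
    using pos_def_norm_bounds[OF assms] by metis
  then obtain a b where ab: "\<And>p. 0 < a p" "\<And>p. 0 < b p"
    "\<And>p x. a p * (norm x)\<^sup>2 \<le> x \<bullet> (Q p *v x)" "\<And>p x. x \<bullet> (Q p *v x) \<le> b p * (norm x)\<^sup>2"
    by metis
  show ?thesis
  proof
    show "0 < Min (range a)" using ab(1) by auto
    show "0 < Max (range b)" using ab(2) by (auto simp: Max_gr_iff)
    show "Min (range a) * (norm x)\<^sup>2 \<le> x \<bullet> (Q p *v x)" for p x
      by (rule order_trans[OF mult_right_mono ab(3)]) auto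
    show "x \<bullet> (Q p *v x) \<le> Max (range b) * (norm x)\<^sup>2" for p x
      by (rule order_trans[OF ab(4) mult_right_mono]) auto
  qed
qed

text \<open>Gronwall argument: the form \<open>V\<close> satisfies V' \<le> c V, so
  \<open>exp (- c * (s - a)) * V s\<close> is nonincreasing. The sign of \<open>c\<close> is free,
  which covers both decay and growth.\<close>

lemma quadratic_form_exp_growth:
  fixes x :: "real \<Rightarrow> real^'n"
  assumes sym: "transpose M = M"
    and le: "M ** B + transpose B ** M \<le>\<^sub>L c *\<^sub>R M"
    and deriv: "\<And>s. s \<in> {a..<b} \<Longrightarrow> (x has_vector_derivative B *v x s) (at s within {a..<b})"
    and t: "t \<in> {a..<b}"
  shows "x t \<bullet> (M *v x t) \<le> exp (c * (t - a)) * (x a \<bullet> (M *v x a))"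
proof -
  define V where "V s = x s \<bullet> (M *v x s)" for s
  define D where "D s = x s \<bullet> (M *v (B *v x s)) + (B *v x s) \<bullet> (M *v x s)" for s
  \<comment> \<open>The half-open interval is cut down to the compact \<open>{a..t}\<close>, where
    the mean value theorem is applied to \<open>g\<close> below.\<close>
  have V: "(V has_real_derivative D s) (at s within {a..t})" if "s \<in> {a..t}" for s
  proof -
    have x: "(x has_vector_derivative B *v x s) (at s within {a..t})"
      by (rule has_vector_derivative_within_subset[OF deriv]) (use t that in auto)
    have "((\<lambda>s. M *v x s) has_vector_derivative M *v (B *v x s)) (at s within {a..t})"
      by (rule bounded_linear.has_vector_derivative[OF matrix_vector_mul_bounded_linear x])
    from bounded_bilinear.has_vector_derivative[OF bounded_bilinear_inner x this]
    show ?thesis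
      unfolding V_def D_def has_real_derivative_iff_has_vector_derivative .
  qed
  have D: "D s \<le> c * V s" for s
    using loewner_leD[OF le, of "x s"]
    by (simp add: D_def V_def matrix_vector_mult_add_rdistrib inner_add_right
        matrix_vector_mul_assoc[symmetric] inner_transpose_matrix scaleR_matrix_vector_assoc[symmetric]
        del: transpose_matrix_vector)
  define g where "g s = exp (- c * (s - a)) * V s" for s
  have g: "(g has_real_derivative exp (- c * (s - a)) * (D s - c * V s)) (at s within {a..t})"
    if "s \<in> {a..t}" for s
    unfolding g_def
    by (rule derivative_eq_intros V[OF that] refl)+ (simp add: algebra_simps)
  obtain s where "s \<in> {a..t}" "g t - g a = (exp (- c * (s - a)) * (D s - c * V s)) * (t - a)"
    using mvt_very_simple[of a t g "\<lambda>s h. (exp (- c * (s - a)) * (D s - c * V s)) * h"] g t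
    by (auto simp: has_field_derivative_def)
  moreover have "(exp (- c * (s - a)) * (D s - c * V s)) * (t - a) \<le> 0"
    using D[of s] t by (intro mult_nonpos_nonneg mult_nonneg_nonpos) auto
  ultimately have "g t \<le> g a" by simp
  then have "exp (c * (t - a)) * g t \<le> exp (c * (t - a)) * V a"
    by (simp add: g_def)
  moreover have "exp (c * (t - a)) * g t = V t"
    by (simp add: g_def mult.assoc[symmetric] exp_add[symmetric])
  ultimately show ?thesis by (simp add: V_def)
qed

section \<open>Counting indices and locating times among the switching times\<close>

lemma card_Collect_less_Suc:
  "card {i. i < Suc k \<and> P i} = card {i. i < k \<and> P i} + (if P k then 1 else 0)"
proof -
  have "{i. i < Suc k \<and> P i} = (if P k then insert k {i. i < k \<and> P i} else {i. i < k \<and> P i})"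
    by (auto simp: less_Suc_eq)
  then show ?thesis by simp
qed

text \<open>The definition gives constancy on the open interval; right continuity at
  \<open>t k\<close> identifies the constant with the value at the left end point.\<close>

lemma has_switching_times_const:
  assumes "has_switching_times \<sigma> t" "s \<in> {t k..<t (Suc k)}"
  shows "\<sigma> s = \<sigma> (t k)"
proof (cases "s = t k")
  case False
  have sm: "strict_mono t" and t0: "t 0 = 0" and const: "\<sigma> constant_on {t k<..<t (Suc k)}"
    and right: "\<forall>s\<ge>0. \<forall>\<^sub>F r in at_right s. \<sigma> r = \<sigma> s"
    using assms(1) unfolding has_switching_times_def by auto
  have "0 \<le> t k" using sm t0 by (metis le0 strict_mono_less_eq)
  with right have "\<forall>\<^sub>F r in at_right (t k). \<sigma> r = \<sigma> (t k)" by blast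
  moreover have "\<forall>\<^sub>F r in at_right (t k). r \<in> {t k<..<t (Suc k)}"
    using sm by (intro eventually_at_right_real) (simp add: strict_mono_less)
  ultimately have "\<forall>\<^sub>F r in at_right (t k). \<sigma> r = \<sigma> (t k) \<and> r \<in> {t k<..<t (Suc k)}"
    by (rule eventually_conj)
  then obtain r where "\<sigma> r = \<sigma> (t k)" "r \<in> {t k<..<t (Suc k)}"
    using eventually_happens[of _ "at_right (t k)"] trivial_limit_at_right_real by blast
  moreover have "s \<in> {t k<..<t (Suc k)}" using assms(2) False by auto
  ultimately show ?thesis using const unfolding constant_on_def by metis
qed simp

text \<open>Since \<open>t\<close> is unbounded there is a least \<open>n\<close> with
  \<open>s < t n\<close>; it is positive because \<open>t 0 = 0\<close>, and \<open>k\<close> is its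
  predecessor.\<close>

lemma has_switching_times_interval:
  assumes "has_switching_times \<sigma> t" "0 \<le> s"
  obtains k where "s \<in> {t k..<t (Suc k)}"
proof -
  have t0: "t 0 = 0" and lim: "filterlim t at_top sequentially"
    using assms(1) unfolding has_switching_times_def by auto
  have "\<exists>n. s < t n"
    using filterlim_at_top_dense[of t sequentially] lim eventually_happens'[OF sequentially_bot]
    by blast
  then obtain n where n: "s < t n" "\<And>m. m < n \<Longrightarrow> \<not> s < t m"
    using exists_least_iff[of "\<lambda>n. s < t n"] by blast
  then obtain k where "n = Suc k" using t0 assms(2) by (cases n) auto
  with n show ?thesis using that[of k] by force
qed

section \<open>Stability of the reset switched system\<close>

theorem theorem4p5:
  fixes A :: "'p::finite \<Rightarrow> real^'n^'n"
    and R :: "'p \<Rightarrow> 'p \<Rightarrow> real^'n^'n"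
    and Q :: "'p \<Rightarrow> real^'n^'n"
    and lam mu :: "'p \<Rightarrow> real"
    and gam :: "'p \<Rightarrow> 'p \<Rightarrow> real"
    and lam_min mu_max gam_max \<tau> \<eta> :: real
    and \<sigma> :: "real \<Rightarrow> 'p"
  assumes "\<And>p. stable_matrix (A p) \<or> unstable_matrix (A p)"
    and "\<And>p. pos_def (Q p)"
    and "\<And>p. p \<in> stable_idx A \<Longrightarrow> 0 < lam p"
    and "\<And>p. p \<in> unstable_idx A \<Longrightarrow> 0 < mu p"
    and "\<And>p q. 0 < gam p q"
    and "\<And>p. p \<in> stable_idx A \<Longrightarrow>
           Q p ** A p + transpose (A p) ** Q p \<le>\<^sub>L (- lam p) *\<^sub>R Q p"
    and "\<And>p. p \<in> unstable_idx A \<Longrightarrow>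
           Q p ** A p + transpose (A p) ** Q p \<le>\<^sub>L mu p *\<^sub>R Q p"
    and "\<And>p q. transpose (R p q) ** Q q ** R p q \<le>\<^sub>L gam p q *\<^sub>R Q p"
    \<comment> \<open>If \<open>stable_idx A\<close> (resp. \<open>unstable_idx A\<close>) is empty, \<open>lam_min\<close> (resp. \<open>mu_max\<close>) is
        unspecified, but it is multiplied by \<open>N_s = 0\<close> (resp. \<open>N_u = 0\<close>) below.\<close>
    and "lam_min = Min (lam ` stable_idx A)"
    and "mu_max = Max (mu ` unstable_idx A)"
    and "gam_max = Max {gam p q | p q. True}"
    and "0 < \<tau>" and "0 < \<eta>"
    and "\<sigma> \<in> signal_class A \<tau> \<eta>"
    and "Limsup at_top (\<lambda>t::real. ereal
           (- lam_min * real (N_s A \<sigma> t) * \<tau> + mu_max * real (N_u A \<sigma> t) * \<eta>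
            + real (N_total A \<sigma> t) * ln gam_max)) < 0"
  shows "reset_stable A R \<sigma>"
proof -
  define S U where "S = stable_idx A" and "U = unstable_idx A"
  define T where "T = switching_time \<sigma>"
  \<comment> \<open>An eigenvalue with positive real part excludes stability, so by the dichotomy
    hypothesis \<open>U\<close> is the complement of \<open>S\<close>.\<close>
  have SU: "p \<in> U \<longleftrightarrow> p \<notin> S" for p
    using assms(1)[of p] unfolding S_def U_def stable_idx_def unstable_idx_def
      stable_matrix_def unstable_matrix_def by force
  have sw: "has_switching_times \<sigma> T"
    using assms(14) has_switching_times_switching_time by (auto simp: signal_class_def T_def)
  then have T0: "T 0 = 0" and sm: "strict_mono T" and lim: "filterlim T at_top sequentially"
    unfolding has_switching_times_def by auto
  have Tnn: "0 \<le> T i" for i using sm T0 by (metis le0 strict_mono_less_eq)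
  have dwellS: "\<tau> \<le> T (Suc k) - T k" if "\<sigma> (T k) \<in> S" for k
    using assms(14) that unfolding signal_class_def S_def T_def by (auto dest!: spec[of _ "Suc k"])
  have dwellU: "T (Suc k) - T k \<le> \<eta>" if "\<sigma> (T k) \<in> U" for k
    using assms(14) that unfolding signal_class_def U_def T_def by (auto dest!: spec[of _ "Suc k"])
  have gam_le: "gam p q \<le> gam_max" for p q
  proof -
    have "{gam p q | p q. True} = (\<lambda>(p, q). gam p q) ` UNIV" by auto
    then have "finite {gam p q | p q. True}" by (metis finite_imageI finite)
    then show ?thesis unfolding assms(11) by (intro Max_ge) auto
  qed
  have gam_pos: "0 < gam_max" using assms(5) gam_le by (rule less_le_trans)
  have lam_le: "lam_min \<le> lam p" if "p \<in> S" for p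
    unfolding assms(9) using that by (auto simp: S_def)
  have mu_le: "mu p \<le> mu_max" if "p \<in> U" for p
    unfolding assms(10) using that by (auto simp: U_def)

  \<comment> \<open>Exponent bound for a whole interval: decay lasts at least \<tau>, growth at most
    \<eta>. An unspecified \<open>lam_min\<close> or \<open>mu_max\<close> never enters, since its
    branch is then unreachable.\<close>
  define c where "c k = (if \<sigma> (T k) \<in> S then - lam_min * \<tau> else mu_max * \<eta>)" for k
  define V where "V x s = x s \<bullet> (Q (\<sigma> s) *v x s)" for x :: "real \<Rightarrow> real^'n" and s
  obtain a b where a: "0 < a" and b: "0 < b"
    and lower: "\<And>p x. a * (norm x)\<^sup>2 \<le> x \<bullet> (Q p *v x)"
    and upper: "\<And>p x. x \<bullet> (Q p *v x) \<le> b * (norm x)\<^sup>2"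
    using pos_def_family_norm_bounds[of Q] assms(2) by metis
  have Q_nonneg: "0 \<le> y \<bullet> (Q p *v y)" for p y
    by (rule order_trans[OF _ lower]) (use a in simp)
  have V_nonneg: "0 \<le> V x s" for x s
    by (simp add: V_def Q_nonneg)

  \<comment> \<open>Evolution of \<open>V\<close> between switching times and across resets\<close>
  define rate where "rate p = (if p \<in> S then - lam p else mu p)" for p
  have deriv: "(x has_vector_derivative A (\<sigma> (T k)) *v x s) (at s within {T k..<T (Suc k)})"
    if "reset_solution A R \<sigma> x" "s \<in> {T k..<T (Suc k)}" for x k s
  proof -
    have "(x has_vector_derivative A (\<sigma> s) *v x s) (at s within {T (Suc k - 1)..<T (Suc k)})"
      using that unfolding reset_solution_def T_def by (auto dest!: spec[of _ "Suc k"])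
    then show ?thesis by (simp add: has_switching_times_const[OF sw that(2)])
  qed
  \<comment> \<open>The form is frozen at the index of the left end point so that the estimate
    survives the left limit at \<open>T (Suc k)\<close>.\<close>
  have growth: "x s \<bullet> (Q (\<sigma> (T k)) *v x s) \<le> exp (rate (\<sigma> (T k)) * (s - T k)) * V x (T k)"
    if "reset_solution A R \<sigma> x" "s \<in> {T k..<T (Suc k)}" for x k s
    unfolding V_def
  proof (rule quadratic_form_exp_growth[OF _ _ deriv[OF that(1)] that(2)])
    show "transpose (Q (\<sigma> (T k))) = Q (\<sigma> (T k))" using assms(2) by (simp add: pos_def_def)
    show "Q (\<sigma> (T k)) ** A (\<sigma> (T k)) + transpose (A (\<sigma> (T k))) ** Q (\<sigma> (T k))
        \<le>\<^sub>L rate (\<sigma> (T k)) *\<^sub>R Q (\<sigma> (T k))"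
      using assms(6,7) SU unfolding rate_def S_def U_def by simp
  qed

  \<comment> \<open>Inside a stable interval the elapsed time may be arbitrarily short, so the
    factor 1 is used there. The \<open>max 0\<close> provides it, whatever the sign of
    \<open>mu_max\<close> when \<open>U\<close> is empty.\<close>
  have growth_le: "V x s \<le> exp (max 0 (mu_max * \<eta>)) * V x (T k)"
    if "reset_solution A R \<sigma> x" "s \<in> {T k..<T (Suc k)}" for x k s
  proof -
    have "rate (\<sigma> (T k)) * (s - T k) \<le> max 0 (mu_max * \<eta>)"
    proof (cases "\<sigma> (T k) \<in> S")
      case True
      then have "0 < lam (\<sigma> (T k))" using assms(3) by (simp add: S_def)
      then have "rate (\<sigma> (T k)) * (s - T k) \<le> 0"
        using True that(2) by (simp add: rate_def)
      then show ?thesis by simp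
    next
      case False
      then have U: "\<sigma> (T k) \<in> U" by (simp add: SU)
      then have "mu (\<sigma> (T k)) * (s - T k) \<le> mu_max * \<eta>"
        using mu_le[OF U] assms(4)[of "\<sigma> (T k)"] dwellU[OF U] that(2)
        by (intro mult_mono) (auto simp: U_def)
      then show ?thesis using False by (simp add: rate_def)
    qed
    then have "exp (rate (\<sigma> (T k)) * (s - T k)) * V x (T k) \<le> exp (max 0 (mu_max * \<eta>)) * V x (T k)"
      by (intro mult_right_mono V_nonneg) simp
    with growth[OF that] show ?thesis
      by (simp add: V_def has_switching_times_const[OF sw that(2)])
  qed

  have jump: "V x (T (Suc k)) \<le> exp (c k + ln gam_max) * V x (T k)"
    if sol: "reset_solution A R \<sigma> x" for x k
  proof -
    let ?p = "\<sigma> (T k)" and ?q = "\<sigma> (T (Suc k))"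
    obtain l where l: "(x \<longlongrightarrow> l) (at_left (T (Suc k)))" "x (T (Suc k)) = R ?p ?q *v l"
      using sol unfolding reset_solution_def T_def by (auto dest!: spec[of _ "Suc k"])
    have less: "T k < T (Suc k)" using sm by (simp add: strict_mono_less)
    \<comment> \<open>The growth estimate passes to the limit just before the reset.\<close>
    have "l \<bullet> (Q ?p *v l) \<le> exp (rate ?p * (T (Suc k) - T k)) * V x (T k)"
    proof (rule tendsto_le)
      show "((\<lambda>s. exp (rate ?p * (s - T k)) * V x (T k)) \<longlongrightarrow>
          exp (rate ?p * (T (Suc k) - T k)) * V x (T k)) (at_left (T (Suc k)))"
        by (intro tendsto_intros)
      show "((\<lambda>s. x s \<bullet> (Q ?p *v x s)) \<longlongrightarrow> l \<bullet> (Q ?p *v l)) (at_left (T (Suc k)))"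
        by (intro tendsto_inner l(1) bounded_linear.tendsto[OF matrix_vector_mul_bounded_linear])
      have "\<forall>\<^sub>F s in at_left (T (Suc k)). s \<in> {T k<..<T (Suc k)}"
        using less by (rule eventually_at_left_real)
      then show "\<forall>\<^sub>F s in at_left (T (Suc k)).
          x s \<bullet> (Q ?p *v x s) \<le> exp (rate ?p * (s - T k)) * V x (T k)"
        by eventually_elim (rule growth[OF sol], simp)
    qed simp
    also have "\<dots> \<le> exp (c k) * V x (T k)"
    proof (intro mult_right_mono V_nonneg)
      have "rate ?p * (T (Suc k) - T k) \<le> c k"
      proof (cases "?p \<in> S")
        case True
        have "lam_min * \<tau> \<le> lam ?p * \<tau>"
          using lam_le[OF True] assms(12) by simp
        also have "\<dots> \<le> lam ?p * (T (Suc k) - T k)"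
          using assms(3)[of ?p] dwellS[OF True] True by (simp add: S_def)
        finally show ?thesis using True by (simp add: rate_def c_def)
      next
        case False
        then have U: "?p \<in> U" by (simp add: SU)
        then have "mu ?p * (T (Suc k) - T k) \<le> mu_max * \<eta>"
          using mu_le[OF U] assms(4)[of ?p] dwellU[OF U] less
          by (intro mult_mono) (auto simp: U_def)
        then show ?thesis using False by (simp add: rate_def c_def)
      qed
      then show "exp (rate ?p * (T (Suc k) - T k)) \<le> exp (c k)" by simp
    qed
    finally have l_le: "l \<bullet> (Q ?p *v l) \<le> exp (c k) * V x (T k)" .
    \<comment> \<open>The reset hypothesis trades the new form at \<open>R ?p ?q *v l\<close> for
      the old form at \<open>l\<close>, at the cost of a factor \<open>gam ?p ?q\<close>.\<close>
    have "V x (T (Suc k)) = l \<bullet> ((transpose (R ?p ?q) ** Q ?q ** R ?p ?q) *v l)"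
      by (simp add: V_def l(2) matrix_vector_mul_assoc[symmetric] inner_transpose_matrix
          del: transpose_matrix_vector)
    also have "\<dots> \<le> gam ?p ?q * (l \<bullet> (Q ?p *v l))"
      using loewner_leD[OF assms(8)] by (simp add: scaleR_matrix_vector_assoc[symmetric])
    also have "\<dots> \<le> gam_max * (exp (c k) * V x (T k))"
      using gam_pos by (intro mult_mono gam_le l_le Q_nonneg) simp
    finally show ?thesis using gam_pos by (simp add: exp_add mult_ac)
  qed

  \<comment> \<open>The accumulated exponent at the switching times\<close>
  define F where "F t = - lam_min * real (N_s A \<sigma> t) * \<tau> + mu_max * real (N_u A \<sigma> t) * \<eta>
    + real (N_total A \<sigma> t) * ln gam_max" for t
  \<comment> \<open>As the counts use strict inequality, \<open>T k\<close> itself is left out: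
    \<open>F (T k)\<close> collects exactly the \<open>k\<close> completed intervals.\<close>
  have counts: "N_s A \<sigma> (T k) = card {i. i < k \<and> \<sigma> (T i) \<in> S}"
    "N_u A \<sigma> (T k) = card {i. i < k \<and> \<sigma> (T i) \<notin> S}" for k
    using Tnn by (simp_all add: N_s_def N_u_def T_def[symmetric] S_def[symmetric] U_def[symmetric]
        SU strict_mono_less[OF sm])
  have F0: "F (T 0) = 0"
    by (simp add: F_def N_total_def counts)
  have FSuc: "F (T (Suc k)) = F (T k) + (c k + ln gam_max)" for k
    by (simp add: F_def N_total_def counts card_Collect_less_Suc c_def algebra_simps)
  have V_le: "V x (T k) \<le> exp (F (T k)) * V x 0" if "reset_solution A R \<sigma> x" for x k
  proof (induction k)
    case 0
    then show ?case by (simp add: F0[unfolded T0] T0)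
  next
    case (Suc k)
    have "V x (T (Suc k)) \<le> exp (c k + ln gam_max) * (exp (F (T k)) * V x 0)"
      by (rule order_trans[OF jump[OF that]]) (intro mult_left_mono Suc, simp)
    then show ?case by (simp add: FSuc exp_add mult_ac)
  qed

  have "\<forall>\<^sub>F t in at_top. F t < 0"
    using Limsup_lessD[OF assms(15)] by (simp add: F_def)
  then have "\<forall>\<^sub>F k in sequentially. F (T k) < 0"
    using lim by (rule eventually_compose_filterlim)
  then obtain K where K: "\<And>k. k \<ge> K \<Longrightarrow> F (T k) < 0"
    by (auto simp: eventually_sequentially)
  \<comment> \<open>Bounds \<open>F\<close> at all switching times: the tail from \<open>K\<close>
    on is negative, and finitely many values remain. Inserting 0 covers the tail and keeps the set
    nonempty.\<close>
  define m where "m = Max (insert 0 ((\<lambda>k. F (T k)) ` {..<K}))"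
  have m: "F (T k) \<le> m" for k
  proof (cases "k < K")
    case False
    then have "F (T k) \<le> 0" using K[of k] by simp
    also have "0 \<le> m" by (simp add: m_def)
    finally show ?thesis .
  qed (auto simp: m_def)

  \<comment> \<open>The factors account for growth within the current interval, growth up to its
    left end point, and the comparison of \<open>V x 0\<close> with the squared norm.\<close>
  define C where "C = exp (max 0 (mu_max * \<eta>)) * exp m * b"
  have C: "0 < C" using b by (simp add: C_def)
  have bound: "a * (norm (x t))\<^sup>2 \<le> C * (norm (x 0))\<^sup>2"
    if sol: "reset_solution A R \<sigma> x" and "0 < t" for x t
  proof -
    obtain k where k: "t \<in> {T k..<T (Suc k)}"
      using has_switching_times_interval[OF sw] \<open>0 < t\<close> by (metis less_imp_le)
    have "a * (norm (x t))\<^sup>2 \<le> V x t" unfolding V_def by (rule lower)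
    also have "\<dots> \<le> exp (max 0 (mu_max * \<eta>)) * V x (T k)" by (rule growth_le[OF sol k])
    also have "V x (T k) \<le> exp (F (T k)) * V x 0" by (rule V_le[OF sol])
    also have "exp (F (T k)) * V x 0 \<le> exp m * (b * (norm (x 0))\<^sup>2)"
      using m[of k] by (intro mult_mono) (simp_all add: V_nonneg, simp add: V_def upper)
    finally show ?thesis by (simp add: C_def mult_ac)
  qed

  show ?thesis
    unfolding reset_stable_def
  proof (intro allI impI)
    fix \<epsilon> :: real assume \<epsilon>: "0 < \<epsilon>"
    show "\<exists>\<delta>>0. \<forall>x. reset_solution A R \<sigma> x \<longrightarrow> norm (x 0) < \<delta> \<longrightarrow> (\<forall>t>0. norm (x t) < \<epsilon>)"
    proof (intro exI conjI allI impI)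
      \<comment> \<open>This \<delta> solves C \<delta>^2 = a \<epsilon>^2, matching
        \<open>bound\<close>.\<close>
      show "0 < sqrt (a / C) * \<epsilon>" using a C \<epsilon> by simp
      fix x t assume sol: "reset_solution A R \<sigma> x" and x0: "norm (x 0) < sqrt (a / C) * \<epsilon>"
        and t: "0 < (t::real)"
      have "C * (norm (x 0))\<^sup>2 < C * (sqrt (a / C) * \<epsilon>)\<^sup>2"
        using x0 C by (intro mult_strict_left_mono power_strict_mono) auto
      also have "\<dots> = a * \<epsilon>\<^sup>2" using a C by (simp add: power_mult_distrib)
      finally have "a * (norm (x t))\<^sup>2 < a * \<epsilon>\<^sup>2" using bound[OF sol t] by linarith
      then have "(norm (x t))\<^sup>2 < \<epsilon>\<^sup>2" using a by simp
      then show "norm (x t) < \<epsilon>" by (rule power2_less_imp_less) (use \<epsilon> in simp)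
    qed
  qed
qed

end
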